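(* Let $\Lambda$ be a $3$-dimensional lattice with a fixed basis, $p$ a prime, and let $$H=\begin{pmatrix} p^{r_1} & h_{12} & h_{13}\\ 0 & p^{r_2} & h_{23}\\ 0&0&p^{r_3}\end{pmatrix}\in \mathrm{HNF}_3(p^r),$$ where $r_1+r_2+r_3=r$, $0\le h_{12}<p^{r_2}$ and $0\le h_{13},h_{23}<p^{r_3}$. Set $u=\mathrm{ord}_p(h_{12}h_{23}-p^{r_2}h_{13})$. Then the sublattice of $\Lambda$ with coefficient matrix $H$ belongs to $\mathcal S(p^s,p^{t-s},p^{r-t})$ for \begin{align*} s&=\min\{r_1,r_2,r_3,\mathrm{ord}_p(h_{12}),\mathrm{ord}_p(h_{13}),\mathrm{ord}_p(h_{23})\},\\ t&=\min\{r_1+r_2,\ r_2+r_3,\ r_1+r_3,\ r_1+\mathrm{ord}_p(h_{23}),\ r_3+\mathrm{ord}_p(h_{12}),\ u\}. \end{align*}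
   Context: A $3$-dimensional lattice is the $\mathbb{Z}$-span of $3$ linearly independent vectors in a Euclidean space; a sublattice of $\Lambda$ is a subset of $\Lambda$ which is itself a $3$-dimensional lattice. The sublattice with coefficient matrix $H$ (with respect to the fixed basis of $\Lambda$) is the one spanned over $\mathbb{Z}$ by the vectors whose coordinates in that basis are the rows of $H$. $\mathrm{HNF}_3(m)$ is the set of upper triangular $3\times3$ integer matrices with positive diagonal entries $h_1,h_2,h_3$, $h_1h_2h_3=m$, and off-diagonal entries satisfying $0\le h_{ij}<h_j$ for $i<j$. For a nonzero integer $a$, $\mathrm{ord}_p(a)$ is the largest $t\ge 0$ such that $p^t\mid a$, and $\mathrm{ord}_p(0)=\infty$. The invariant factors of a sublattice are the diagonal entries $d_1\mid d_2\mid d_3$ (positive integers) of the Smith normal form of a coefficient matrix; they do not depend on the choices of bases. $\mathcal S(d_1,d_2,d_3)$ is the set of all sublattices of $\Lambda$ with invariant factors $d_1,d_2,d_3$ (a class under the equivalence: $\Lambda^*\sim\Lambda^\bullet$ if there is a linear transformation $\sigma$ with $\sigma(\Lambda)=\Lambda$, $\sigma(\Lambda^* )=\Lambda^\bullet$). *)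

theory Defs
  imports "HOL-Analysis.Analysis" "HOL-Computational_Algebra.Computational_Algebra"
    "HOL-Library.Extended_Nat"
begin

definition int_span :: "(3 \<Rightarrow> 'a::real_vector) \<Rightarrow> 'a set" where
  "int_span b = {\<Sum>i\<in>UNIV. of_int (c i) *\<^sub>R b i | c :: 3 \<Rightarrow> int. True}"

text \<open>The ambient Euclidean space may have dimension larger than 3.\<close>

definition lattice_basis :: "(3 \<Rightarrow> 'a::euclidean_space) \<Rightarrow> 'a set \<Rightarrow> bool" where
  "lattice_basis b L \<longleftrightarrow> inj b \<and> independent (range b) \<and> L = int_span b"

definition is_lattice3 :: "'a::euclidean_space set \<Rightarrow> bool" where
  "is_lattice3 L \<longleftrightarrow> (\<exists>b. lattice_basis b L)"

definition sublattice :: "'a::euclidean_space set \<Rightarrow> 'a set \<Rightarrow> bool" where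
  "sublattice M L \<longleftrightarrow> M \<subseteq> L \<and> is_lattice3 M"

definition lattice_of_matrix :: "(3 \<Rightarrow> 'a::euclidean_space) \<Rightarrow> int^3^3 \<Rightarrow> 'a set" where
  "lattice_of_matrix b H = int_span (\<lambda>i. \<Sum>j\<in>UNIV. of_int (H $ i $ j) *\<^sub>R b j)"

definition mat3 :: "int \<Rightarrow> int \<Rightarrow> int \<Rightarrow> int \<Rightarrow> int \<Rightarrow> int \<Rightarrow> int \<Rightarrow> int \<Rightarrow> int \<Rightarrow> int^3^3" where
  "mat3 a11 a12 a13 a21 a22 a23 a31 a32 a33 =
     vector [vector [a11, a12, a13], vector [a21, a22, a23], vector [a31, a32, a33]]"

text \<open>The entries are listed explicitly because the order on the index type \<open>3\<close> is not the
  matrix order: there \<open>3 = 0\<close> is the least element.\<close>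

definition HNF3 :: "int \<Rightarrow> (int^3^3) set" where
  "HNF3 m = {mat3 h1 h12 h13 0 h2 h23 0 0 h3 | h1 h2 h3 h12 h13 h23.
     0 < h1 \<and> 0 < h2 \<and> 0 < h3 \<and> h1 * h2 * h3 = m \<and>
     0 \<le> h12 \<and> h12 < h2 \<and> 0 \<le> h13 \<and> h13 < h3 \<and> 0 \<le> h23 \<and> h23 < h3}"

definition ord_at :: "int \<Rightarrow> int \<Rightarrow> enat" where
  "ord_at p a = (if a = 0 then \<infinity> else enat (multiplicity p a))"

text \<open>\<open>invertible\<close> is meant over the integers here, i.e. \<open>U\<close> and \<open>V\<close> are unimodular. Only
  nonsingular matrices have a Smith normal form in this sense, all \<open>d\<^sub>i\<close> being positive.\<close>

definition has_smith_normal_form :: "int^3^3 \<Rightarrow> int \<Rightarrow> int \<Rightarrow> int \<Rightarrow> bool" where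
  "has_smith_normal_form A d1 d2 d3 \<longleftrightarrow>
     0 < d1 \<and> 0 < d2 \<and> 0 < d3 \<and> d1 dvd d2 \<and> d2 dvd d3 \<and>
     (\<exists>U V :: int^3^3. invertible U \<and> invertible V \<and>
        U ** A ** V = mat3 d1 0 0 0 d2 0 0 0 d3)"

definition has_invariant_factors ::
    "'a::euclidean_space set \<Rightarrow> 'a set \<Rightarrow> int \<Rightarrow> int \<Rightarrow> int \<Rightarrow> bool" where
  "has_invariant_factors L M d1 d2 d3 \<longleftrightarrow>
     (\<exists>b A. lattice_basis b L \<and> M = lattice_of_matrix b A \<and> has_smith_normal_form A d1 d2 d3)"

definition sublattice_class ::
    "'a::euclidean_space set \<Rightarrow> int \<Rightarrow> int \<Rightarrow> int \<Rightarrow> 'a set set" where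
  "sublattice_class L d1 d2 d3 = {M. sublattice M L \<and> has_invariant_factors L M d1 d2 d3}"

end

theory Submission imports Defs begin

text \<open>
  Every integer matrix is equivalent, under multiplication by unimodular matrices on both sides, to
  a diagonal one (\<open>unimod_equiv_diagonal\<close>). Let \<open>B\<close> be the adjugate of \<open>H\<close>, so that
  \<open>H ** B = mat (p ^ r)\<close>. This equation survives the passage to the diagonal form, so each
  diagonal entry divides \<open>p ^ r\<close> and is, up to sign, a power of \<open>p\<close>. Powers of \<open>p\<close> are
  totally ordered by divisibility; a permutation therefore turns the diagonal form into the Smith
  form \<open>p ^ e\<^sub>1, p ^ e\<^sub>2, p ^ e\<^sub>3\<close> with \<open>e\<^sub>1 \<le> e\<^sub>2 \<le> e\<^sub>3\<close>.

  The exponents are identified by three invariants. Whether an integer divides all entries of a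
  matrix does not change under unimodular equivalence (\<open>dvd_entries_unimod_iff\<close>). Applied to \<open>H\<close>,
  this makes \<open>e\<^sub>1\<close> the least order of an entry of \<open>H\<close>, which is \<open>s\<close>. Applied to \<open>B\<close>, whose
  diagonal form has the entries \<open>p ^ (r - e\<^sub>i)\<close>, it makes \<open>r - e\<^sub>3\<close> the least order of an entry
  of \<open>B\<close>; these entries are up to sign the \<open>2 \<times> 2\<close> minors of \<open>H\<close>, so this order is \<open>t\<close>.
  Finally the determinant gives \<open>e\<^sub>1 + e\<^sub>2 + e\<^sub>3 = r\<close>. All of this is \<open>smith_normal_form_primepow\<close>.

  The equation \<open>H ** B = mat (p ^ r)\<close> also shows that the rows of \<open>H\<close> are linearly independent,
  so that they span a sublattice (\<open>sublattice_lattice_of_matrix\<close>).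
\<close>

(* The infix $ is kept for vector components only. *)
no_notation fps_nth (infixl \<open>$\<close> 75)

section \<open>Unimodular equivalence of integer matrices\<close>

definition unimod_equiv :: "int^'n^'n \<Rightarrow> int^'n^'n \<Rightarrow> bool" where
  "unimod_equiv A B \<longleftrightarrow> (\<exists>U V. invertible U \<and> invertible V \<and> U ** A ** V = B)"

lemma invertible_matrix_mult:
  fixes A B :: "'a::comm_semiring_1^'n^'n"
  assumes "invertible A" "invertible B"
  shows "invertible (A ** B)"
proof -
  obtain A' B' where "A ** A' = mat 1" "A' ** A = mat 1" "B ** B' = mat 1" "B' ** B = mat 1"
    using assms unfolding invertible_def by blast
  then have "A ** B ** (B' ** A') = mat 1" "B' ** A' ** (A ** B) = mat 1"
    by (metis matrix_mul_assoc matrix_mul_rid)+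
  then show ?thesis unfolding invertible_def by blast
qed

lemma invertible_matrix_transpose:
  fixes A :: "'a::comm_semiring_1^'n^'n"
  assumes "invertible A"
  shows "invertible (transpose A)"
  using assms unfolding invertible_def
  by (metis matrix_transpose_mul transpose_mat)

lemma transpose_nth: "transpose A $ i $ j = A $ j $ i"
  by (simp add: transpose_def)

lemma invertible_mat_1: "invertible (mat 1 :: 'a::comm_semiring_1^'n^'n)"
  unfolding invertible_def by (metis matrix_mul_lid)

lemma unimod_equiv_refl: "unimod_equiv A A"
  unfolding unimod_equiv_def using invertible_mat_1 by (metis matrix_mul_lid matrix_mul_rid)

lemma unimod_equiv_trans:
  assumes "unimod_equiv A B" "unimod_equiv B C"
  shows "unimod_equiv A C"
proof -
  obtain U V U' V' where inv: "invertible U" "invertible V" "invertible U'" "invertible V'"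
    and "U ** A ** V = B" "U' ** B ** V' = C"
    using assms unfolding unimod_equiv_def by blast
  then have "(U' ** U) ** A ** (V ** V') = C" by (metis matrix_mul_assoc)
  then show ?thesis unfolding unimod_equiv_def using inv invertible_matrix_mult by blast
qed

lemma unimod_equiv_transpose:
  assumes "unimod_equiv A B"
  shows "unimod_equiv (transpose A) (transpose B)"
proof -
  obtain U V where inv: "invertible U" "invertible V" and "U ** A ** V = B"
    using assms unfolding unimod_equiv_def by blast
  then have "transpose V ** transpose A ** transpose U = transpose B"
    by (metis matrix_mul_assoc matrix_transpose_mul)
  then show ?thesis
    unfolding unimod_equiv_def using inv invertible_matrix_transpose by blast
qed

lemma unimod_equiv_left_mult: "invertible U \<Longrightarrow> unimod_equiv A (U ** A)"
  unfolding unimod_equiv_def using invertible_mat_1 by (metis matrix_mul_rid)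

lemma dvd_entries_matrix_mult:
  fixes A :: "'a::comm_semiring_1^'n^'m"
  assumes "\<forall>i j. m dvd A $ i $ j"
  shows "\<forall>i j. m dvd (U ** A ** V) $ i $ j"
  unfolding matrix_matrix_mult_def
  by (clarsimp, intro dvd_sum dvd_mult2[OF dvd_sum] dvd_mult) (simp add: assms)

text \<open>The gcd of all entries is an invariant of unimodular equivalence: the entries of
  \<open>U ** A ** V\<close> are integer combinations of those of \<open>A\<close>, and conversely.\<close>

lemma dvd_entries_unimod_iff:
  assumes "invertible U" "invertible V"
  shows "(\<forall>i j. m dvd (U ** A ** V) $ i $ j) \<longleftrightarrow> (\<forall>i j. m dvd (A :: int^'n^'n) $ i $ j)"
proof -
  obtain U' V' where "U' ** U = mat 1" "V ** V' = mat 1"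
    using assms unfolding invertible_def by blast
  then have "U' ** (U ** A ** V) ** V' = A"
    by (metis matrix_mul_assoc matrix_mul_lid matrix_mul_rid)
  then show ?thesis by (metis dvd_entries_matrix_mult)
qed

section \<open>Diagonalization\<close>

text \<open>Left multiplication by \<open>shear k q\<close> adds \<open>q i\<close> times row \<open>k\<close> to every other row
  \<open>i\<close>, all at once. Row \<open>k\<close> itself stays fixed, which makes \<open>- q\<close> give the inverse.\<close>

definition shear :: "'n \<Rightarrow> ('n \<Rightarrow> int) \<Rightarrow> int^'n^'n" where
  "shear k q = (\<chi> i j. (if i = j then 1 else 0) + (if j = k \<and> i \<noteq> k then q i else 0))"

definition perm_matrix :: "('n \<Rightarrow> 'n) \<Rightarrow> int^'n^'n" where
  "perm_matrix \<sigma> = (\<chi> i j. if j = \<sigma> i then 1 else 0)"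

lemma shear_mult: "(shear k q ** A) $ i $ j = A $ i $ j + (if i = k then 0 else q i * A $ k $ j)"
  by (simp add: shear_def matrix_matrix_mult_def distrib_right sum.distrib if_distrib[of "\<lambda>x. x * _"]
      cong: if_cong)

lemma perm_matrix_mult: "(perm_matrix \<sigma> ** A) $ i $ j = A $ \<sigma> i $ j"
  by (simp add: perm_matrix_def matrix_matrix_mult_def if_distrib[of "\<lambda>x. x * _"] cong: if_cong)

lemma invertible_shear: "invertible (shear k q)"
proof -
  have "shear k f ** shear k g = mat 1" if "\<And>i. f i = - g i" for f g
    by (simp add: vec_eq_iff shear_mult) (simp add: shear_def mat_def that)
  from this[of q "\<lambda>i. - q i"] this[of "\<lambda>i. - q i" q]
  show ?thesis unfolding invertible_def by auto
qed

lemma invertible_perm_matrix: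
  assumes "bij \<sigma>"
  shows "invertible (perm_matrix \<sigma>)"
proof -
  have "perm_matrix f ** perm_matrix g = mat 1" if "\<And>i. g (f i) = i" for f g :: "'a \<Rightarrow> 'a"
    by (simp add: vec_eq_iff perm_matrix_mult) (auto simp: perm_matrix_def mat_def that)
  from this[of "inv \<sigma>" \<sigma>] this[of \<sigma> "inv \<sigma>"] assms
  show ?thesis unfolding invertible_def
    by (metis bij_inv_eq_iff)
qed

text \<open>Diagonalization isolates one index after another. Since the index type has no preferred
  order, the processed indices form an arbitrary set \<open>S\<close> rather than an initial segment.\<close>

definition isolated :: "int^'n^'n \<Rightarrow> 'n \<Rightarrow> bool" where
  "isolated A i \<longleftrightarrow> (\<forall>j. j \<noteq> i \<longrightarrow> A $ i $ j = 0 \<and> A $ j $ i = 0)"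

lemma isolated_transpose [simp]: "isolated (transpose A) i \<longleftrightarrow> isolated A i"
  by (auto simp: isolated_def transpose_nth)

text \<open>A nonzero entry of column \<open>k\<close> lies in a row outside \<open>S\<close>, so exchanging that row with row
  \<open>k\<close> leaves the processed indices isolated.\<close>

lemma exists_pivot_in_column:
  assumes S: "\<forall>i\<in>S. isolated A i" and k: "k \<notin> S" and ne: "A $ i $ k \<noteq> 0"
  shows "\<exists>B. unimod_equiv A B \<and> (\<forall>i\<in>S. isolated B i) \<and> B $ k $ k = A $ i $ k"
proof -
  let ?B = "perm_matrix (Transposition.transpose i k) ** A"
  have i: "i \<notin> S" using assms by (metis isolated_def)
  have "isolated ?B l" if "l \<in> S" for l
  proof -
    have "l \<noteq> i" "l \<noteq> k" using that i k by auto
    then show ?thesis using S that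
      by (auto simp: isolated_def perm_matrix_mult Transposition.transpose_def)
  qed
  moreover have "unimod_equiv A ?B"
    by (intro unimod_equiv_left_mult invertible_perm_matrix) simp
  ultimately show ?thesis by (intro exI[of _ ?B]) (simp add: perm_matrix_mult)
qed

text \<open>The Euclidean step, with a minimal pivot in place of a recursion: subtracting multiples of
  row \<open>k\<close> leaves remainders modulo the pivot in column \<open>k\<close>, and a nonzero remainder could be
  moved to the diagonal as a smaller pivot. Row \<open>k\<close> is unchanged, so the step
  can be repeated on the transpose without spoiling what was gained.\<close>

lemma clear_column:
  assumes S: "\<forall>i\<in>S. isolated A i" and k: "k \<notin> S" and ne: "A $ k $ k \<noteq> 0"
    and min: "\<And>B. unimod_equiv A B \<Longrightarrow> \<forall>i\<in>S. isolated B i \<Longrightarrow> B $ k $ k \<noteq> 0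
      \<Longrightarrow> \<bar>A $ k $ k\<bar> \<le> \<bar>B $ k $ k\<bar>"
  shows "\<exists>B. unimod_equiv A B \<and> (\<forall>i\<in>S. isolated B i) \<and> (\<forall>j. j \<noteq> k \<longrightarrow> B $ j $ k = 0) \<and>
    (\<forall>j. B $ k $ j = A $ k $ j)"
proof -
  define B where "B = shear k (\<lambda>i. - (A $ i $ k div A $ k $ k)) ** A"
  have B_nth: "B $ i $ j = A $ i $ j - (if i = k then 0 else A $ i $ k div A $ k $ k * A $ k $ j)"
    for i j by (simp add: B_def shear_mult)
  have eq: "unimod_equiv A B"
    unfolding B_def by (intro unimod_equiv_left_mult invertible_shear)
  have iso: "\<forall>l\<in>S. isolated B l"
  proof
    fix l assume "l \<in> S"
    then have "l \<noteq> k" "\<And>j. j \<noteq> l \<Longrightarrow> A $ l $ j = 0 \<and> A $ j $ l = 0"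
      using S k by (auto simp: isolated_def)
    then show "isolated B l" by (auto simp: isolated_def B_nth)
  qed
  have "B $ j $ k = 0" if "j \<noteq> k" for j
  proof (rule ccontr)
    assume nz: "B $ j $ k \<noteq> 0"
    have "B $ j $ k = A $ j $ k mod A $ k $ k"
      using that by (simp add: B_nth minus_div_mult_eq_mod)
    then have less: "\<bar>B $ j $ k\<bar> < \<bar>A $ k $ k\<bar>" using ne by (simp add: abs_mod_less)
    obtain C where C: "unimod_equiv B C" "\<forall>i\<in>S. isolated C i" "C $ k $ k = B $ j $ k"
      using exists_pivot_in_column[OF iso k nz] by blast
    then have "\<bar>A $ k $ k\<bar> \<le> \<bar>C $ k $ k\<bar>"
      using min[OF unimod_equiv_trans[OF eq C(1)] C(2)] nz by simp
    with less C(3) show False by simp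
  qed
  moreover have "\<forall>j. B $ k $ j = A $ k $ j" by (simp add: B_nth)
  ultimately show ?thesis using eq iso by (intro exI[of _ B] conjI allI impI) blast+
qed

text \<open>Choose, among all equivalent matrices in which \<open>S\<close> is isolated, one whose pivot at \<open>k\<close> is
  nonzero and minimal in absolute value; then clear column \<open>k\<close> and, by transposition, row \<open>k\<close>. If
  no such matrix has a nonzero pivot, then row and column \<open>k\<close> already vanish.\<close>

lemma isolate_index:
  assumes S: "\<forall>i\<in>S. isolated A i" and k: "k \<notin> S"
  shows "\<exists>B. unimod_equiv A B \<and> (\<forall>i\<in>insert k S. isolated B i)"
proof (cases "\<exists>B. unimod_equiv A B \<and> (\<forall>i\<in>S. isolated B i) \<and> B $ k $ k \<noteq> 0")
  case True
  define P where "P B \<longleftrightarrow> unimod_equiv A B \<and> (\<forall>i\<in>S. isolated B i) \<and> B $ k $ k \<noteq> 0" for B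
  from True obtain B0 where "P B0" unfolding P_def by blast
  from ex_has_least_nat[of P, OF this, of "\<lambda>B. nat \<bar>B $ k $ k\<bar>"] obtain B
    where "P B" and min: "\<And>C. P C \<Longrightarrow> nat \<bar>B $ k $ k\<bar> \<le> nat \<bar>C $ k $ k\<bar>"
    by blast
  then have B: "unimod_equiv A B" "\<forall>i\<in>S. isolated B i" "B $ k $ k \<noteq> 0"
    by (simp_all add: P_def)
  have min': "\<bar>B $ k $ k\<bar> \<le> \<bar>C $ k $ k\<bar>"
    if "unimod_equiv B C" "\<forall>i\<in>S. isolated C i" "C $ k $ k \<noteq> 0" for C
    using min[of C] that unimod_equiv_trans[OF B(1) that(1)] by (simp add: P_def)
  have "\<forall>i\<in>S. isolated B i" "B $ k $ k \<noteq> 0" using B by simp_all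
  from clear_column[OF this(1) k this(2) min'] obtain C where
    C: "unimod_equiv B C" "\<forall>i\<in>S. isolated C i"
      "\<forall>j. j \<noteq> k \<longrightarrow> C $ j $ k = 0" "\<forall>j. C $ k $ j = B $ k $ j"
    by blast
  \<comment> \<open>Transposition preserves equivalence, isolation and the entry at \<open>k\<close>, hence minimality.\<close>
  have min'': "\<bar>transpose C $ k $ k\<bar> \<le> \<bar>D $ k $ k\<bar>"
    if "unimod_equiv (transpose C) D" "\<forall>i\<in>S. isolated D i" "D $ k $ k \<noteq> 0" for D
  proof -
    have "unimod_equiv B (transpose D)"
      using that(1) C(1) by (metis unimod_equiv_transpose transpose_transpose unimod_equiv_trans)
    from min'[OF this] that C(4) show ?thesis by (simp add: transpose_nth)
  qed
  have "\<forall>i\<in>S. isolated (transpose C) i" "transpose C $ k $ k \<noteq> 0"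
    using C B by (auto simp: transpose_nth isolated_def)
  from clear_column[OF this(1) k this(2) min''] obtain D where
    D: "unimod_equiv (transpose C) D" "\<forall>i\<in>S. isolated D i"
      "\<forall>j. j \<noteq> k \<longrightarrow> D $ j $ k = 0" "\<forall>j. D $ k $ j = transpose C $ k $ j"
    by blast
  have "isolated D k" using D(3,4) C(3) by (auto simp: isolated_def transpose_nth)
  then have "\<forall>i\<in>insert k S. isolated (transpose D) i" using D by simp
  moreover have "unimod_equiv A (transpose D)"
    using B C(1) D(1) by (metis unimod_equiv_transpose transpose_transpose unimod_equiv_trans)
  ultimately show ?thesis by blast
next
  case False
  have "A $ i $ k = 0" for i
    using exists_pivot_in_column[OF S k] False by metis
  moreover have "A $ k $ i = 0" for i
  proof (rule ccontr)
    assume "A $ k $ i \<noteq> 0"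
    then have "transpose A $ i $ k \<noteq> 0" by (simp add: transpose_nth)
    moreover have "\<forall>i\<in>S. isolated (transpose A) i" using S by simp
    ultimately obtain B where B: "unimod_equiv (transpose A) B" "\<forall>i\<in>S. isolated B i"
        "B $ k $ k = A $ k $ i"
      using exists_pivot_in_column[OF _ k] by (metis transpose_nth)
    from B(1) have "unimod_equiv A (transpose B)" by (metis unimod_equiv_transpose transpose_transpose)
    moreover have "\<forall>i\<in>S. isolated (transpose B) i" "transpose B $ k $ k \<noteq> 0"
      using B(2,3) \<open>A $ k $ i \<noteq> 0\<close> by (simp_all add: transpose_nth)
    ultimately show False using False by blast
  qed
  ultimately have "isolated A k" by (simp add: isolated_def)
  then show ?thesis using S unimod_equiv_refl by blast
qed

lemma unimod_equiv_diagonal: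
  fixes A :: "int^'n^'n"
  shows "\<exists>D. unimod_equiv A D \<and> (\<forall>i j. i \<noteq> j \<longrightarrow> D $ i $ j = 0)"
proof -
  have "\<exists>D. unimod_equiv A D \<and> (\<forall>i\<in>S. isolated D i)" if "finite S" for S :: "'n set"
    using that
  proof (induction S rule: finite_induct)
    case empty
    show ?case using unimod_equiv_refl by blast
  next
    case (insert k S)
    then show ?case using isolate_index unimod_equiv_trans by meson
  qed
  from this[of UNIV] show ?thesis by (auto simp: isolated_def)
qed

section \<open>Smith normal forms of prime power determinant\<close>

definition diag_matrix :: "('n \<Rightarrow> int) \<Rightarrow> int^'n^'n" where
  "diag_matrix d = (\<chi> i j. if i = j then d i else 0)"

lemma diag_matrix_mult: "(diag_matrix d ** A) $ i $ j = d i * A $ i $ j"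
  by (simp add: diag_matrix_def matrix_matrix_mult_def if_distrib[of "\<lambda>x. x * _"] cong: if_cong)

lemma mat_commute: "A ** mat c = mat c ** A"
  for A :: "'a::comm_semiring_1^'n^'n"
  by (simp add: mat_def matrix_matrix_mult_def vec_eq_iff if_distrib[of "\<lambda>x. x * _"]
      if_distrib[of "\<lambda>x. _ * x"] mult.commute cong: if_cong)

text \<open>If \<open>B\<close> is \<open>c\<close> times the inverse of \<open>A\<close>, then \<open>B\<close> transforms contragrediently. With
  \<open>U ** A ** V\<close> diagonal, this exhibits a diagonal form of \<open>B\<close> as well.\<close>

lemma mult_scalar_unimod:
  fixes A B U V U' V' :: "int^'n^'n"
  assumes "A ** B = mat c" "U ** U' = mat 1" "V ** V' = mat 1"
  shows "(U ** A ** V) ** (V' ** B ** U') = mat c"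
proof -
  have "(U ** A ** V) ** (V' ** B ** U') = U ** (A ** (V ** V') ** B) ** U'"
    by (simp add: matrix_mul_assoc)
  also have "\<dots> = U ** mat c ** U'" by (simp add: assms)
  also have "\<dots> = mat c ** (U ** U')" by (simp only: mat_commute[of U] matrix_mul_assoc)
  finally show ?thesis using assms by simp
qed

text \<open>The hypothesis on \<open>B\<close> forces each diagonal entry of a diagonal form of \<open>A\<close> to divide
  \<open>p ^ r\<close>; a diagonal matrix of signs then makes these entries positive.\<close>

lemma unimod_equiv_primepow_diagonal:
  fixes A B :: "int^'n^'n"
  assumes p: "prime p" and AB: "A ** B = mat (p ^ r)"
  shows "\<exists>e. unimod_equiv A (diag_matrix (\<lambda>i. p ^ e i))"
proof -
  obtain D where "unimod_equiv A D" and diag: "\<And>i j. i \<noteq> j \<Longrightarrow> D $ i $ j = 0"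
    using unimod_equiv_diagonal[of A] by blast
  then obtain U V where inv: "invertible U" "invertible V" and UAV: "U ** A ** V = D"
    unfolding unimod_equiv_def by blast
  define d where "d i = D $ i $ i" for i
  have D: "U ** A ** V = diag_matrix d"
    using diag by (auto simp: UAV vec_eq_iff d_def diag_matrix_def)
  obtain U' V' where "U ** U' = mat 1" "V ** V' = mat 1"
    using inv unfolding invertible_def by blast
  from mult_scalar_unimod[OF AB this] have *: "diag_matrix d ** (V' ** B ** U') = mat (p ^ r)"
    by (simp add: D)
  have "d i * (V' ** B ** U') $ i $ i = p ^ r" for i
    using arg_cong[OF *, of "\<lambda>M. M $ i $ i"] unfolding diag_matrix_mult by (simp add: mat_def)
  then have "d i dvd p ^ r" for i by (metis dvd_triv_left)
  then have "\<exists>k. \<bar>d i\<bar> = p ^ k" for i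
    using divides_primepow_weak[OF p, of "d i" r] prime_gt_0_int[OF p]
    by (auto simp: normalize_int_def simp del: normalize_power)
  then obtain e where e: "\<And>i. \<bar>d i\<bar> = p ^ e i" by metis
  have nz: "d i \<noteq> 0" for i using e[of i] p by (metis abs_zero power_not_zero not_prime_0)
  let ?S = "diag_matrix (\<lambda>i. sgn (d i))"
  have "?S ** ?S = mat 1"
    by (simp add: vec_eq_iff diag_matrix_mult)
      (simp add: diag_matrix_def mat_def nz flip: sgn_mult)
  then have "invertible ?S" unfolding invertible_def by blast
  moreover have "?S ** (U ** A ** V) = diag_matrix (\<lambda>i. p ^ e i)"
    unfolding D by (simp add: vec_eq_iff diag_matrix_mult)
      (auto simp: diag_matrix_def e[symmetric] abs_sgn mult.commute)
  ultimately have "unimod_equiv (U ** A ** V) (diag_matrix (\<lambda>i. p ^ e i))"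
    using unimod_equiv_left_mult[of ?S "U ** A ** V"] by simp
  then show ?thesis
    using unimod_equiv_trans \<open>unimod_equiv A D\<close> UAV by blast
qed

text \<open>Conjugation by a permutation matrix permutes the diagonal. The right factor is obtained by
  applying the row rule to the transpose.\<close>

lemma unimod_equiv_permute_diag:
  assumes "bij \<sigma>"
  shows "unimod_equiv (diag_matrix d) (diag_matrix (d \<circ> \<sigma>))"
proof -
  let ?P = "perm_matrix \<sigma>"
  have "?P ** diag_matrix d ** transpose ?P = ?P ** transpose (?P ** transpose (diag_matrix d))"
    by (simp add: matrix_transpose_mul matrix_mul_assoc)
  also have "\<dots> = diag_matrix (d \<circ> \<sigma>)"
    using bij_is_inj[OF assms]
    by (auto simp: vec_eq_iff perm_matrix_mult) 
      (auto simp: transpose_nth perm_matrix_mult diag_matrix_def inj_eq)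
  finally show ?thesis
    unfolding unimod_equiv_def using invertible_perm_matrix[OF assms] invertible_matrix_transpose
    by blast
qed

lemma sort_3:
  fixes e :: "3 \<Rightarrow> 'a::linorder"
  shows "\<exists>\<sigma> :: 3 \<Rightarrow> 3. bij \<sigma> \<and> e (\<sigma> 1) \<le> e (\<sigma> 2) \<and> e (\<sigma> 2) \<le> e (\<sigma> 3)"
proof -
  have *: ?thesis if "{x, y, z} = UNIV" "e x \<le> e y" "e y \<le> e z" for x y z
  proof -
    define \<sigma> where "\<sigma> i = (if i = 1 then x else if i = 2 then y else z)" for i :: 3
    have s: "\<sigma> 1 = x" "\<sigma> 2 = y" "\<sigma> 3 = z" by (simp_all add: \<sigma>_def)
    have "surj \<sigma>" using that(1) s by (metis UNIV_3 image_insert image_empty)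
    then have "bij \<sigma>" by (metis bij_def finite finite_UNIV_surj_inj)
    then show ?thesis using s that by (intro exI[of _ \<sigma>]) simp
  qed
  have "{1,2,3} = (UNIV :: 3 set)" "{1,3,2} = (UNIV :: 3 set)" "{2,1,3} = (UNIV :: 3 set)"
     "{2,3,1} = (UNIV :: 3 set)" "{3,1,2} = (UNIV :: 3 set)" "{3,2,1} = (UNIV :: 3 set)"
    by (auto simp: UNIV_3)
  with * show ?thesis by (metis linear)
qed

lemma mat3_nth [simp]:
  "mat3 a b c d e f g h i $ 1 $ 1 = a" "mat3 a b c d e f g h i $ 1 $ 2 = b"
  "mat3 a b c d e f g h i $ 1 $ 3 = c" "mat3 a b c d e f g h i $ 2 $ 1 = d"
  "mat3 a b c d e f g h i $ 2 $ 2 = e" "mat3 a b c d e f g h i $ 2 $ 3 = f"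
  "mat3 a b c d e f g h i $ 3 $ 1 = g" "mat3 a b c d e f g h i $ 3 $ 2 = h"
  "mat3 a b c d e f g h i $ 3 $ 3 = i"
  by (simp_all add: mat3_def)

lemma diag_matrix_3: "diag_matrix d = mat3 (d 1) 0 0 0 (d 2) 0 0 0 (d 3)"
  by (simp add: vec_eq_iff forall_3 diag_matrix_def)

lemma abs_det_unimod:
  fixes U :: "int^'n^'n"
  assumes "invertible U"
  shows "\<bar>det U\<bar> = 1"
proof -
  obtain U' where "U ** U' = mat 1" using assms unfolding invertible_def by blast
  then have "det U * det U' = 1" by (metis det_I det_mul)
  then show ?thesis by (metis zmult_eq_1_iff abs_1 abs_minus)
qed

text \<open>The hypotheses on \<open>s\<close> and \<open>t\<close> say that \<open>p ^ s\<close> and \<open>p ^ t\<close> are the exact powers of \<open>p\<close>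
  dividing all entries of \<open>A\<close> and of its adjugate \<open>B\<close>. Writing \<open>p ^ e i\<close> for the sorted diagonal
  form of \<open>A\<close>, the corresponding form of \<open>B\<close> has the entries \<open>p ^ (r - e i)\<close>, the smallest of
  which belongs to \<open>e 3\<close>.\<close>

lemma smith_normal_form_primepow:
  fixes A B :: "int^3^3"
  assumes p: "prime p" and AB: "A ** B = mat (p ^ r)" and det: "det A = p ^ r"
    and s: "\<And>k. (\<forall>i j. p ^ k dvd A $ i $ j) \<longleftrightarrow> k \<le> s"
    and t: "\<And>k. (\<forall>i j. p ^ k dvd B $ i $ j) \<longleftrightarrow> k \<le> t"
  shows "has_smith_normal_form A (p ^ s) (p ^ (t - s)) (p ^ (r - t))"
proof -
  have p1: "p > 1" using p by (rule prime_gt_1_int)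
  then have pow_dvd: "p ^ m dvd p ^ n \<longleftrightarrow> m \<le> n" for m n
    by (simp add: dvd_power_iff)
  obtain e0 where "unimod_equiv A (diag_matrix (\<lambda>i. p ^ e0 i))"
    using unimod_equiv_primepow_diagonal[OF p AB] by blast
  moreover obtain \<sigma> :: "3 \<Rightarrow> 3" where \<sigma>: "bij \<sigma>" "e0 (\<sigma> 1) \<le> e0 (\<sigma> 2)" "e0 (\<sigma> 2) \<le> e0 (\<sigma> 3)"
    using sort_3 by blast
  ultimately have "unimod_equiv A (diag_matrix ((\<lambda>i. p ^ e0 i) \<circ> \<sigma>))"
    using unimod_equiv_permute_diag unimod_equiv_trans by blast
  moreover define e where "e = e0 \<circ> \<sigma>"
  ultimately have "unimod_equiv A (diag_matrix (\<lambda>i. p ^ e i))" by (simp add: comp_def)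
  then obtain U V where inv: "invertible U" "invertible V"
    and D: "U ** A ** V = diag_matrix (\<lambda>i. p ^ e i)"
    unfolding unimod_equiv_def by blast
  have le: "e 1 \<le> e 2" "e 2 \<le> e 3" using \<sigma> by (simp_all add: e_def)
  have "k \<le> s \<longleftrightarrow> k \<le> e 1" for k
    unfolding s[symmetric] dvd_entries_unimod_iff[OF inv, of "p ^ k" A, symmetric] D
    using le by (auto simp: forall_3 diag_matrix_3 pow_dvd)
  then have s_eq: "s = e 1" by (metis order_antisym order_refl)
  obtain U' V' where inv': "U ** U' = mat 1" "V ** V' = mat 1" "U' ** U = mat 1" "V' ** V = mat 1"
    using inv unfolding invertible_def by blast
  then have "invertible U'" "invertible V'" unfolding invertible_def by blast+
  note dvd_B = dvd_entries_unimod_iff[OF this(2,1), of _ B]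
  define C where "C = V' ** B ** U'"
  have *: "diag_matrix (\<lambda>i. p ^ e i) ** C = mat (p ^ r)"
    using mult_scalar_unimod[OF AB inv'(1,2)] by (simp add: D C_def)
  have C: "p ^ e i * C $ i $ j = (if i = j then p ^ r else 0)" for i j
    using arg_cong[OF *, of "\<lambda>M. M $ i $ j"] unfolding diag_matrix_mult by (simp add: mat_def)
  have e_le: "e i \<le> r" for i
    using C[of i i] pow_dvd by (metis dvd_triv_left)
  have C_eq: "C $ i $ j = (if i = j then p ^ (r - e i) else 0)" for i j
  proof -
    have "p ^ e i * p ^ (r - e i) = p ^ r" using e_le by (metis le_add_diff_inverse power_add)
    then have "p ^ e i * C $ i $ j = p ^ e i * (if i = j then p ^ (r - e i) else 0)"
      using C[of i j] by auto
    then show ?thesis using p1 by simp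
  qed
  have "k \<le> t \<longleftrightarrow> k \<le> r - e 3" for k
    unfolding t[symmetric] dvd_B[symmetric] C_def[symmetric] C_eq
    using le by (auto simp: forall_3 pow_dvd)
  then have t_eq: "t = r - e 3" by (metis order_antisym order_refl)
  have "\<bar>det (U ** A ** V)\<bar> = p ^ r"
    using p1 by (simp add: det_mul abs_mult abs_det_unimod inv det)
  then have "p ^ (e 1 + e 2 + e 3) = p ^ r"
    using p1 unfolding D diag_matrix_3 by (simp add: det_3 power_add abs_mult)
  then have "e 1 + e 2 + e 3 = r" using p1 by simp
  then have "t - s = e 2" "r - t = e 3" using s_eq t_eq by auto
  moreover have "U ** A ** V = mat3 (p ^ e 1) 0 0 0 (p ^ e 2) 0 0 0 (p ^ e 3)"
    unfolding D diag_matrix_3 ..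
  ultimately show ?thesis
    unfolding has_smith_normal_form_def using s_eq inv p1 le pow_dvd by auto
qed

section \<open>Sublattices\<close>

text \<open>Linear independence of a family, as opposed to that of its range: coefficients are indexed
  by \<open>i\<close>, which is what matrix arithmetic produces.\<close>

lemma inj_independent_range_iff:
  fixes b :: "'n::finite \<Rightarrow> 'a::euclidean_space"
  shows "inj b \<and> independent (range b) \<longleftrightarrow>
    (\<forall>x. (\<Sum>i\<in>UNIV. x i *\<^sub>R b i) = 0 \<longrightarrow> (\<forall>i. x i = 0))" (is "?L \<longleftrightarrow> ?R")
proof
  assume L: ?L
  show ?R
  proof (intro allI impI)
    fix x i assume 0: "(\<Sum>i\<in>UNIV. x i *\<^sub>R b i) = 0"
    have "(\<Sum>v\<in>range b. x (inv b v) *\<^sub>R v) = (\<Sum>i\<in>UNIV. x i *\<^sub>R b i)"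
      using L by (subst sum.reindex) auto
    with 0 L have "\<forall>v\<in>range b. x (inv b v) = 0"
      unfolding independent_explicit by metis
    then show "x i = 0" using L by simp
  qed
next
  assume R: ?R
  have inj: "inj b"
  proof (rule injI, rule ccontr)
    fix i j assume ij: "b i = b j" "i \<noteq> j"
    \<comment> \<open>The coefficients of the nontrivial relation \<open>b i - b j = 0\<close>.\<close>
    let ?x = "\<lambda>l. (if l = i then 1 else 0) - (if l = j then 1 else 0 :: real)"
    have "(\<Sum>l\<in>UNIV. ?x l *\<^sub>R b l) = b i - b j"
      by (simp add: scaleR_diff_left sum_subtractf if_distrib[of "\<lambda>x. x *\<^sub>R _"] cong: if_cong)
    then have "(\<Sum>l\<in>UNIV. ?x l *\<^sub>R b l) = 0" using ij by simp
    with R[rule_format, of ?x] have "?x i = 0" by blast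
    then show False using ij by simp
  qed
  have "independent (range b)"
    unfolding independent_explicit
  proof (intro conjI allI impI)
    fix c assume "(\<Sum>v\<in>range b. c v *\<^sub>R v) = 0"
    then have "(\<Sum>i\<in>UNIV. c (b i) *\<^sub>R b i) = 0" using inj by (subst (asm) sum.reindex) auto
    then show "\<forall>v\<in>range b. c v = 0" using R by auto
  qed simp
  with inj show ?L by blast
qed

text \<open>A relation \<open>x\<close> between the spanning vectors satisfies \<open>x A = 0\<close>, because \<open>b\<close> is a basis.
  Multiplying by \<open>B\<close> gives \<open>m x = 0\<close>, hence \<open>x = 0\<close>.\<close>

lemma sublattice_lattice_of_matrix:
  fixes A B :: "int^3^3"
  assumes b: "lattice_basis b \<Lambda>" and AB: "A ** B = mat m" and m: "m \<noteq> 0"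
  shows "sublattice (lattice_of_matrix b A) \<Lambda>"
proof -
  let ?c = "\<lambda>i. \<Sum>j\<in>UNIV. of_int (A $ i $ j) *\<^sub>R b j"
  have comb: "(\<Sum>i\<in>UNIV. x i *\<^sub>R ?c i) = (\<Sum>j\<in>UNIV. (\<Sum>i\<in>UNIV. x i * of_int (A $ i $ j)) *\<^sub>R b j)"
    for x
    unfolding scaleR_sum_left scaleR_sum_right scaleR_scaleR by (rule sum.swap)
  have b_indep: "y j = 0" if "(\<Sum>j\<in>UNIV. y j *\<^sub>R b j) = 0" for y j
    using inj_independent_range_iff[of b] b that unfolding lattice_basis_def by blast
  have c_indep: "x l = 0" if "(\<Sum>i\<in>UNIV. x i *\<^sub>R ?c i) = 0" for x l
  proof -
    have xA: "(\<Sum>i\<in>UNIV. x i * of_int (A $ i $ j)) = 0" for j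
      using that unfolding comb by (rule b_indep)
    have "0 = (\<Sum>j\<in>UNIV. (\<Sum>i\<in>UNIV. x i * of_int (A $ i $ j)) * of_int (B $ j $ l))"
      using xA by simp
    also have "\<dots> = (\<Sum>i\<in>UNIV. x i * of_int ((A ** B) $ i $ l))"
      unfolding sum_distrib_right matrix_matrix_mult_def
      by (subst sum.swap) (simp add: sum_distrib_left mult.assoc)
    also have "\<dots> = x l * of_int m"
      unfolding AB by (simp add: mat_def if_distrib[of "\<lambda>x. _ * x"] if_distrib[of of_int] cong: if_cong)
    finally show ?thesis using m by simp
  qed
  have "inj ?c \<and> independent (range ?c)"
    unfolding inj_independent_range_iff using c_indep by blast
  then have "lattice_basis ?c (lattice_of_matrix b A)"
    by (simp add: lattice_basis_def lattice_of_matrix_def)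
  moreover have "lattice_of_matrix b A \<subseteq> \<Lambda>"
  proof
    fix y assume "y \<in> lattice_of_matrix b A"
    then obtain x :: "3 \<Rightarrow> int" where "y = (\<Sum>i\<in>UNIV. of_int (x i) *\<^sub>R ?c i)"
      unfolding lattice_of_matrix_def int_span_def by blast
    then have "y = (\<Sum>j\<in>UNIV. of_int (\<Sum>i\<in>UNIV. x i * A $ i $ j) *\<^sub>R b j)"
      unfolding comb by simp
    then have "y \<in> int_span b"
      unfolding int_span_def
      by (intro CollectI exI[of _ "\<lambda>j. \<Sum>i\<in>UNIV. x i * A $ i $ j"]) simp
    then show "y \<in> \<Lambda>" using b unfolding lattice_basis_def by simp
  qed
  ultimately show ?thesis unfolding sublattice_def is_lattice3_def by blast
qed

section \<open>Reading off the exponents\<close>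

lemma power_dvd_iff_le_ord_at:
  assumes "prime p"
  shows "p ^ k dvd a \<longleftrightarrow> enat k \<le> ord_at p a"
  using assms by (auto simp: ord_at_def power_dvd_iff_le_multiplicity)

lemma power_dvd_power_mult_iff:
  assumes "prime p"
  shows "p ^ k dvd p ^ m * a \<longleftrightarrow> enat k \<le> enat m + ord_at p a"
proof (cases "a = 0")
  case False
  then have "multiplicity p (p ^ m * a) = m + multiplicity p a"
    using assms prime_imp_prime_elem[OF assms] not_prime_unit[of p]
    by (subst prime_elem_multiplicity_mult_distrib) (auto simp: multiplicity_same_power)
  with False show ?thesis using assms
    by (auto simp: power_dvd_iff_le_ord_at ord_at_def)
qed (simp add: ord_at_def)

theorem theorem3p2:
  fixes \<Lambda> :: "'a::euclidean_space set" and b :: "3 \<Rightarrow> 'a"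
    and p :: int and H :: "int^3^3" and h12 h13 h23 :: int
    and r r1 r2 r3 s t :: nat and u :: enat
  assumes "lattice_basis b \<Lambda>"
    and "prime p"
    and "H = mat3 (p ^ r1) h12 h13
                  0 (p ^ r2) h23
                  0 0 (p ^ r3)"
    and "H \<in> HNF3 (p ^ r)"
    and "r1 + r2 + r3 = r"
    and "0 \<le> h12" and "h12 < p ^ r2"
    and "0 \<le> h13" and "h13 < p ^ r3"
    and "0 \<le> h23" and "h23 < p ^ r3"
    and "u = ord_at p (h12 * h23 - p ^ r2 * h13)"
    and "enat s = Min {enat r1, enat r2, enat r3, ord_at p h12, ord_at p h13, ord_at p h23}"
    and "enat t = Min {enat (r1 + r2), enat (r2 + r3), enat (r1 + r3),
                       enat r1 + ord_at p h23, enat r3 + ord_at p h12, u}"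
  shows "lattice_of_matrix b H \<in> sublattice_class \<Lambda> (p ^ s) (p ^ (t - s)) (p ^ (r - t))"
proof -
  note p = \<open>prime p\<close>
  have p1: "p > 1" using p by (rule prime_gt_1_int)
  then have pow_dvd: "p ^ m dvd p ^ n \<longleftrightarrow> m \<le> n" for m n
    by (simp add: dvd_power_iff)
  note H = \<open>H = _\<close> and r = \<open>r1 + r2 + r3 = r\<close>
  \<comment> \<open>The adjugate of \<open>H\<close>; its entries are the signed \<open>2 \<times> 2\<close> minors.\<close>
  define B where "B = mat3 (p ^ (r2 + r3)) (- (p ^ r3 * h12)) (h12 * h23 - p ^ r2 * h13)
                           0 (p ^ (r1 + r3)) (- (p ^ r1 * h23))
                           0 0 (p ^ (r1 + r2))"
  have HB: "H ** B = mat (p ^ r)"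
    by (simp add: vec_eq_iff forall_3 matrix_matrix_mult_def sum_3 H B_def mat_def
        r[symmetric] power_add algebra_simps)
  have det: "det H = p ^ r"
    by (simp add: det_3 H r[symmetric] power_add)
  have s: "(\<forall>i j. p ^ k dvd H $ i $ j) \<longleftrightarrow> k \<le> s" for k
  proof -
    have "k \<le> s \<longleftrightarrow> enat k \<le> enat s" by simp
    also have "\<dots> \<longleftrightarrow> (\<forall>i j. p ^ k dvd H $ i $ j)"
      unfolding \<open>enat s = _\<close>
      by (auto simp: forall_3 H pow_dvd power_dvd_iff_le_ord_at[OF p, of _ h12]
          power_dvd_iff_le_ord_at[OF p, of _ h13] power_dvd_iff_le_ord_at[OF p, of _ h23])
    finally show ?thesis ..
  qed
  have t: "(\<forall>i j. p ^ k dvd B $ i $ j) \<longleftrightarrow> k \<le> t" for k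
  proof -
    have "k \<le> t \<longleftrightarrow> enat k \<le> enat t" by simp
    also have "\<dots> \<longleftrightarrow> (\<forall>i j. p ^ k dvd B $ i $ j)"
      unfolding \<open>enat t = _\<close> \<open>u = _\<close>
      by (auto simp: forall_3 B_def pow_dvd power_dvd_power_mult_iff[OF p]
          power_dvd_iff_le_ord_at[OF p, of _ "h12 * h23 - p ^ r2 * h13"])
    finally show ?thesis ..
  qed
  have "has_smith_normal_form H (p ^ s) (p ^ (t - s)) (p ^ (r - t))"
    using smith_normal_form_primepow[OF p HB det s t] .
  moreover have "sublattice (lattice_of_matrix b H) \<Lambda>"
    using sublattice_lattice_of_matrix[OF \<open>lattice_basis b \<Lambda>\<close> HB] p1 by simp
  ultimately show ?thesis
    unfolding sublattice_class_def has_invariant_factors_def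
    using \<open>lattice_basis b \<Lambda>\<close> by blast
qed

end
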